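(* Let $Y$ be a random vector in $\mathbb{R}^d$, $A\in\mathbb{R}^{d\times d}$ invertible, $\varepsilon=AY$ with $\mathbb{E}\varepsilon=0$, $\mathrm{var}(\varepsilon)=I_d$ and finite third moments. Suppose that $\varepsilon$ satisfies one of the following conditions. (a) $\varepsilon=\tau\odot\eta$ with $\tau=\phi(KZ)$, where $K\in\mathbb{R}^{d\times m}$ is a fixed matrix, $\eta\in\mathbb{R}^d$ and $Z\in\mathbb{R}^m$ are independent random vectors, each with independent components, and $\phi:\mathbb{R}\to\mathbb{R}_{>0}$ is applied coordinatewise. (b) $\mathbb{E}(\varepsilon_i\mid\varepsilon_{-i})=0$ for $i=1,\dots,d$. Then $h_3(\varepsilon)=\mu_3(\varepsilon)=\kappa_3(\varepsilon)$ is a diagonal tensor. If additionally $h_3(\varepsilon)_{iii}\neq0$ for at least $d-1$ different values of $i\in\{1,\dots,d\}$, then $A$ is identifiable up to permuting and swapping signs of its rows, i.e. $$\{B\in\mathbb{R}^{d\times d}\text{ invertible}: \mathrm{var}(BY)=I_d,\ h_3(BY)\text{ is diagonal}\}=\{QA:Q\in\mathrm{SP}(d)\}.$$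
   Context: For a mean-zero random vector $X$ in $\mathbb{R}^d$, $\mu_3(X)_{ijk}=\mathbb{E}[X_iX_jX_k]$ is the third-order moment tensor and $\kappa_3(X)_{ijk}=\mathrm{cum}(X_i,X_j,X_k)$ the third-order joint cumulant tensor; $h_3$ denotes either. A tensor $T$ is diagonal if $T_{ijk}=0$ unless $i=j=k$. $\odot$ is the coordinatewise (Hadamard) product. $\varepsilon_{-i}$ is $\varepsilon$ with its $i$-th coordinate removed. $\mathrm{SP}(d)$ is the set of $d\times d$ signed permutation matrices, i.e. matrices $DP$ with $D$ diagonal with $\pm1$ diagonal entries and $P$ a permutation matrix. *)

theory Defs
  imports "HOL-Probability.Probability"
begin

type_synonym 'n tensor3 = "'n \<Rightarrow> 'n \<Rightarrow> 'n \<Rightarrow> real"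

definition diagonal_tensor :: "'n tensor3 \<Rightarrow> bool" where
  "diagonal_tensor T \<longleftrightarrow> (\<forall>i j k. \<not> (i = j \<and> j = k) \<longrightarrow> T i j k = 0)"

definition moment3 :: "'a measure \<Rightarrow> ('a \<Rightarrow> real ^ 'n) \<Rightarrow> 'n tensor3" where
  "moment3 M X i j k = (\<integral>\<omega>. X \<omega> $ i * X \<omega> $ j * X \<omega> $ k \<partial>M)"

text \<open>The joint cumulant of a finite family of random variables, by the partition formula. The
  family is indexed by \<open>S\<close>, so that the same random variable may occur several times in it.\<close>

definition joint_cumulant :: "'a measure \<Rightarrow> 'i set \<Rightarrow> ('i \<Rightarrow> 'a \<Rightarrow> real) \<Rightarrow> real" where
  "joint_cumulant M S X =
    (\<Sum>\<pi> | partition_on S \<pi>.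
       (- 1) ^ (card \<pi> - 1) * fact (card \<pi> - 1) * (\<Prod>B\<in>\<pi>. \<integral>\<omega>. (\<Prod>p\<in>B. X p \<omega>) \<partial>M))"

definition cumulant3 :: "'a measure \<Rightarrow> ('a \<Rightarrow> real ^ 'n) \<Rightarrow> 'n tensor3" where
  "cumulant3 M X i j k = joint_cumulant M {0, 1, 2::nat} (\<lambda>p \<omega>. X \<omega> $ ([i, j, k] ! p))"

definition covariance_matrix :: "'a measure \<Rightarrow> ('a \<Rightarrow> real ^ 'n) \<Rightarrow> real ^ 'n ^ 'n" where
  "covariance_matrix M X =
    (\<chi> i j. \<integral>\<omega>. (X \<omega> $ i - (\<integral>\<omega>'. X \<omega>' $ i \<partial>M)) * (X \<omega> $ j - (\<integral>\<omega>'. X \<omega>' $ j \<partial>M)) \<partial>M)"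

definition signed_permutation_matrices :: "(real ^ 'n ^ 'n) set" where
  "signed_permutation_matrices =
    {D ** P | D P.
       (\<exists>s. (\<forall>i. s i \<in> {-1, 1}) \<and> D = (\<chi> i j. if i = j then s i else 0)) \<and>
       (\<exists>\<sigma>. bij \<sigma> \<and> P = (\<chi> i j. if j = \<sigma> i then 1 else 0))}"

definition independent_components :: "'a measure \<Rightarrow> ('a \<Rightarrow> real ^ 'n) \<Rightarrow> bool" where
  "independent_components M X \<longleftrightarrow>
    prob_space.indep_vars M (\<lambda>_. borel) (\<lambda>i \<omega>. X \<omega> $ i) UNIV"

text \<open>The library's \<open>indep_var\<close> needs both random variables to have the same type, so this is its
  characterization by the generated \<open>\<sigma>\<close>-algebras, for vectors of different dimensions.\<close>

definition independent_vectors ::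
  "'a measure \<Rightarrow> ('a \<Rightarrow> real ^ 'n) \<Rightarrow> ('a \<Rightarrow> real ^ 'm) \<Rightarrow> bool" where
  "independent_vectors M X Z \<longleftrightarrow>
    X \<in> borel_measurable M \<and> Z \<in> borel_measurable M \<and>
    prob_space.indep_set M {X -` B \<inter> space M | B. B \<in> sets borel}
      {Z -` B \<inter> space M | B. B \<in> sets borel}"

text \<open>\<open>\<epsilon> = \<phi>(KZ) \<odot> \<eta>\<close> almost surely.\<close>

definition scale_mixture ::
  "'a measure \<Rightarrow> ('a \<Rightarrow> real ^ 'n) \<Rightarrow> (real \<Rightarrow> real) \<Rightarrow> real ^ 'm ^ 'n \<Rightarrow>
    ('a \<Rightarrow> real ^ 'm) \<Rightarrow> ('a \<Rightarrow> real ^ 'n) \<Rightarrow> bool" where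
  "scale_mixture M \<epsilon> \<phi> K Z \<eta> \<longleftrightarrow>
    \<phi> \<in> borel_measurable borel \<and> (\<forall>x. 0 < \<phi> x) \<and>
    independent_vectors M \<eta> Z \<and>
    independent_components M \<eta> \<and> independent_components M Z \<and>
    (AE \<omega> in M. \<epsilon> \<omega> = (\<chi> i. \<phi> ((K *v Z \<omega>) $ i) * \<eta> \<omega> $ i))"

text \<open>The \<open>\<sigma>\<close>-algebra on the sample space generated by \<open>X\<close> with its \<open>i\<close>-th coordinate removed.\<close>

definition sigma_without :: "'a measure \<Rightarrow> ('a \<Rightarrow> real ^ 'n) \<Rightarrow> 'n \<Rightarrow> 'a measure" where
  "sigma_without M X i =
    vimage_algebra (space M) (\<lambda>\<omega>. \<lambda>j\<in>UNIV - {i}. X \<omega> $ j) (Pi\<^sub>M (UNIV - {i}) (\<lambda>_. borel))"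

definition mean_independent :: "'a measure \<Rightarrow> ('a \<Rightarrow> real ^ 'n) \<Rightarrow> bool" where
  "mean_independent M X \<longleftrightarrow>
    (\<forall>i. AE \<omega> in M. real_cond_exp M (sigma_without M X i) (\<lambda>\<omega>. X \<omega> $ i) \<omega> = 0)"

text \<open>The library's \<open>real_cond_exp\<close> is a conditional expectation only for a subalgebra.\<close>

lemma subalgebra_sigma_without:
  fixes X :: "'a \<Rightarrow> real ^ 'n"
  assumes "X \<in> borel_measurable M"
  shows "subalgebra M (sigma_without M X i)"
proof -
  have "(\<lambda>\<omega>. \<lambda>j\<in>UNIV - {i}. X \<omega> $ j) \<in> M \<rightarrow>\<^sub>M Pi\<^sub>M (UNIV - {i}) (\<lambda>_. borel)"
    using assms by (intro measurable_restrict) (auto intro: measurable_compose[OF _ borel_measurable_nth])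
  then show ?thesis
    unfolding sigma_without_def subalgebra_def
    by (simp add: sets_image_in_sets)
qed

end

theory Submission
  imports Defs
begin

text \<open>For a mean-zero vector every partition of three indices with more than one block has a
  singleton block, so \<open>\<kappa>\<^sub>3 = \<mu>\<^sub>3\<close>. If \<open>i\<close> differs from \<open>j\<close> and \<open>k\<close>, then
  \<open>E[\<epsilon>\<^sub>i \<epsilon>\<^sub>j \<epsilon>\<^sub>k]\<close> has a vanishing factor: in case (a) it is
  \<open>E[\<tau>\<^sub>i \<tau>\<^sub>j \<tau>\<^sub>k] E[\<eta>\<^sub>i] E[\<eta>\<^sub>j \<eta>\<^sub>k]\<close>, where \<open>E[\<tau>\<^sub>i] E[\<eta>\<^sub>i] = 0\<close> with
  \<open>\<tau>\<^sub>i > 0\<close>; in case (b) condition on \<open>\<epsilon>\<close> without its \<open>i\<close>-th coordinate. Finally, for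
  \<open>Q = B A\<^sup>-\<^sup>1\<close> the covariance condition says that \<open>Q\<close> is orthogonal, and diagonality of the
  transformed tensor forces any two rows of \<open>Q\<close> to have disjoint supports.\<close>

section \<open>Integrability of triple products; third cumulants of centred vectors\<close>

declare borel_measurable_nth [measurable]

lemma prod_le_sum_cubes:
  fixes x y z :: real
  assumes "0 \<le> x" "0 \<le> y" "0 \<le> z"
  shows "x * y * z \<le> x ^ 3 + y ^ 3 + z ^ 3"
proof -
  define m where "m = max x (max y z)"
  have "0 \<le> m" "x \<le> m" "y \<le> m" "z \<le> m"
    using assms by (auto simp: m_def)
  then have "x * y * z \<le> m * m * m"
    using assms by (intro mult_mono) auto
  also have "\<dots> = m ^ 3"
    by (simp add: power3_eq_cube)
  also have "m \<in> {x, y, z}"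
    by (auto simp: m_def max_def)
  then have "m ^ 3 \<le> x ^ 3 + y ^ 3 + z ^ 3"
    using assms by auto
  finally show ?thesis .
qed

text \<open>The sum of the three absolute cubes dominates the product. With the constant 1 in place
  of some factors, finite third moments also yield the first and second moments on a probability
  space.\<close>

lemma integrable_mult3:
  fixes f g h :: "'a \<Rightarrow> real"
  assumes [measurable]: "f \<in> borel_measurable M" "g \<in> borel_measurable M" "h \<in> borel_measurable M"
    and "integrable M (\<lambda>x. \<bar>f x\<bar> ^ 3)" "integrable M (\<lambda>x. \<bar>g x\<bar> ^ 3)"
      "integrable M (\<lambda>x. \<bar>h x\<bar> ^ 3)"
  shows "integrable M (\<lambda>x. f x * g x * h x)"
proof (rule Bochner_Integration.integrable_bound)
  show "integrable M (\<lambda>x. \<bar>f x\<bar> ^ 3 + \<bar>g x\<bar> ^ 3 + \<bar>h x\<bar> ^ 3)"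
    using assms by simp
  show "AE x in M. norm (f x * g x * h x) \<le> norm (\<bar>f x\<bar> ^ 3 + \<bar>g x\<bar> ^ 3 + \<bar>h x\<bar> ^ 3)"
  proof (intro AE_I2)
    fix x
    have "norm (f x * g x * h x) \<le> \<bar>f x\<bar> ^ 3 + \<bar>g x\<bar> ^ 3 + \<bar>h x\<bar> ^ 3"
      using prod_le_sum_cubes[of "\<bar>f x\<bar>" "\<bar>g x\<bar>" "\<bar>h x\<bar>"] by (simp add: abs_mult)
    also have "\<dots> \<le> norm (\<bar>f x\<bar> ^ 3 + \<bar>g x\<bar> ^ 3 + \<bar>h x\<bar> ^ 3)"
      by simp
    finally show "norm (f x * g x * h x) \<le> norm (\<bar>f x\<bar> ^ 3 + \<bar>g x\<bar> ^ 3 + \<bar>h x\<bar> ^ 3)" .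
  qed
qed simp

lemma cumulant3_eq_moment3:
  fixes X :: "'a \<Rightarrow> real ^ 'n"
  assumes mean: "\<And>i. (\<integral>\<omega>. X \<omega> $ i \<partial>M) = 0"
  shows "cumulant3 M X = moment3 M X"
proof (intro ext)
  fix i j k :: 'n
  let ?S = "{0, 1, 2::nat}"
  let ?X = "\<lambda>p \<omega>. X \<omega> $ ([i, j, k] ! p)"
  let ?f = "\<lambda>\<pi>. (- 1) ^ (card \<pi> - 1) * fact (card \<pi> - 1) *
    (\<Prod>B\<in>\<pi>. \<integral>\<omega>. (\<Prod>p\<in>B. ?X p \<omega>) \<partial>M)"
  have "?f \<pi> = 0" if \<pi>: "partition_on ?S \<pi>" and ne: "\<pi> \<noteq> {?S}" for \<pi>
  proof -
    have fin: "finite \<pi>"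
      using finite_elements[OF _ \<pi>] by simp
    have card_sum: "(\<Sum>B\<in>\<pi>. card B) = 3"
    proof -
      have "card (\<Union>\<pi>) = (\<Sum>B\<in>\<pi>. card B)"
      proof (rule card_Union_disjoint[OF partition_onD2[OF \<pi>]])
        fix B assume "B \<in> \<pi>"
        then have "B \<subseteq> ?S" using partition_onD1[OF \<pi>] by auto
        then show "finite B" by (rule finite_subset) simp
      qed
      then show ?thesis
        by (simp add: partition_onD1[OF \<pi>, symmetric])
    qed
    \<comment> \<open>If all blocks had size at least 2, three points would leave room for only one
      block, and \<pi> would be the excluded partition \<open>{?S}\<close>.\<close>
    have "\<exists>B\<in>\<pi>. card B = 1"
    proof (rule ccontr)
      assume none: "\<not> (\<exists>B\<in>\<pi>. card B = 1)"
      have ge2: "2 \<le> card B" if "B \<in> \<pi>" for B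
      proof -
        have "B \<subseteq> ?S" using partition_onD1[OF \<pi>] that by auto
        then have "finite B" by (rule finite_subset) simp
        moreover have "B \<noteq> {}" using partition_onD3[OF \<pi>] that by auto
        ultimately have "card B \<noteq> 0" by simp
        moreover have "card B \<noteq> 1" using none that by blast
        ultimately show ?thesis by linarith
      qed
      have "card \<pi> * 2 \<le> (\<Sum>B\<in>\<pi>. card B)"
        using sum_bounded_below[of \<pi> "2::nat" card] ge2 by simp
      then have "card \<pi> \<le> 1" using card_sum by simp
      moreover have "card \<pi> \<noteq> 0" using card_sum fin by auto
      ultimately have "card \<pi> = 1" by simp
      then obtain B where "\<pi> = {B}" by (auto simp: card_1_singleton_iff)
      then show False using ne partition_onD1[OF \<pi>] by simp
    qed
    then obtain B p where "B \<in> \<pi>" "B = {p}" by (auto simp: card_1_singleton_iff)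
    \<comment> \<open>The singleton block contributes the mean of one coordinate, which is
      0.\<close>
    then have "\<exists>B\<in>\<pi>. (\<integral>\<omega>. (\<Prod>p\<in>B. ?X p \<omega>) \<partial>M) = 0"
      using mean by (intro bexI[of _ B]) auto
    then have "(\<Prod>B\<in>\<pi>. \<integral>\<omega>. (\<Prod>p\<in>B. ?X p \<omega>) \<partial>M) = 0"
      using fin by (simp add: prod_zero_iff)
    then show ?thesis by simp
  qed
  then have "(\<Sum>\<pi> | partition_on ?S \<pi>. ?f \<pi>) = (\<Sum>\<pi>\<in>{{?S}}. ?f \<pi>)"
    using finitely_many_partition_on[of ?S]
    by (intro sum.mono_neutral_right) (auto intro: partition_on_space)
  then show "cumulant3 M X i j k = moment3 M X i j k"
    by (simp add: cumulant3_def joint_cumulant_def moment3_def mult.assoc)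
qed

section \<open>Integrals and independence\<close>

text \<open>For the nonnegative functions \<open>\<bar>P\<bar>\<close> and
  \<open>\<bar>T\<bar>\<close> the product formula holds with values in [0, \<infinity>]. If the
  product is finite and one factor is nonzero, the other factor is finite.\<close>

lemma (in prob_space) indep_var_integrable_factor:
  fixes P T :: "'a \<Rightarrow> real"
  assumes ind: "indep_var borel P borel T"
    and int: "integrable M (\<lambda>\<omega>. P \<omega> * T \<omega>)"
  shows "\<not> (AE \<omega> in M. P \<omega> = 0) \<Longrightarrow> integrable M T"
    and "\<not> (AE \<omega> in M. T \<omega> = 0) \<Longrightarrow> integrable M P"
proof -
  have [measurable]: "P \<in> borel_measurable M" "T \<in> borel_measurable M"
    using ind by (auto dest: indep_var_rv1 indep_var_rv2)
  let ?X = "case_bool (\<lambda>\<omega>. ennreal \<bar>P \<omega>\<bar>) (\<lambda>\<omega>. ennreal \<bar>T \<omega>\<bar>)"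
  have "indep_var borel ((\<lambda>x. ennreal \<bar>x\<bar>) \<circ> P) borel ((\<lambda>x. ennreal \<bar>x\<bar>) \<circ> T)"
    using ind by (rule indep_var_compose) measurable
  then have "indep_vars (case_bool borel borel) ?X UNIV"
    by (simp add: indep_var_def comp_def)
  moreover have "case_bool borel borel = (\<lambda>_. borel :: ennreal measure)"
    by (auto simp: fun_eq_iff split: bool.split)
  ultimately have "indep_vars (\<lambda>_. borel) ?X UNIV"
    by simp
  then have "(\<integral>\<^sup>+\<omega>. (\<Prod>b\<in>UNIV. ?X b \<omega>) \<partial>M) = (\<Prod>b\<in>UNIV. \<integral>\<^sup>+\<omega>. ?X b \<omega> \<partial>M)"
    by (intro indep_vars_nn_integral) auto
  then have eq: "(\<integral>\<^sup>+\<omega>. ennreal \<bar>P \<omega> * T \<omega>\<bar> \<partial>M) =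
      (\<integral>\<^sup>+\<omega>. ennreal \<bar>P \<omega>\<bar> \<partial>M) * (\<integral>\<^sup>+\<omega>. ennreal \<bar>T \<omega>\<bar> \<partial>M)"
    by (simp add: UNIV_bool abs_mult ennreal_mult mult.commute)
  have fin: "(\<integral>\<^sup>+\<omega>. ennreal \<bar>P \<omega> * T \<omega>\<bar> \<partial>M) < \<infinity>"
    using int by (simp add: integrable_iff_bounded)
  \<comment> \<open>Rules out 0 * \<infinity> = 0, the only way in which a finite product could hide
    an infinite factor.\<close>
  have nz: "(\<integral>\<^sup>+\<omega>. ennreal \<bar>f \<omega>\<bar> \<partial>M) \<noteq> 0"
    if "\<not> (AE \<omega> in M. f \<omega> = 0)" "f \<in> borel_measurable M" for f :: "'a \<Rightarrow> real"
    using that by (subst nn_integral_0_iff_AE) auto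
  show "integrable M T" if "\<not> (AE \<omega> in M. P \<omega> = 0)"
    using fin nz[OF that] unfolding eq by (auto simp: integrable_iff_bounded ennreal_mult_less_top)
  show "integrable M P" if "\<not> (AE \<omega> in M. T \<omega> = 0)"
    using fin nz[OF that] unfolding eq by (auto simp: integrable_iff_bounded ennreal_mult_less_top)
qed

text \<open>No integrability is needed: if one factor is not integrable, its integral is \<open>0\<close> by
  convention, and the product is then either not integrable as well or almost surely \<open>0\<close>.\<close>

lemma (in prob_space) indep_var_integral_mult:
  fixes P T :: "'a \<Rightarrow> real"
  assumes ind: "indep_var borel P borel T"
  shows "(\<integral>\<omega>. P \<omega> * T \<omega> \<partial>M) = (\<integral>\<omega>. P \<omega> \<partial>M) * (\<integral>\<omega>. T \<omega> \<partial>M)"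
proof -
  have [measurable]: "P \<in> borel_measurable M" "T \<in> borel_measurable M"
    using ind by (auto dest: indep_var_rv1 indep_var_rv2)
  consider "AE \<omega> in M. P \<omega> = 0" | "AE \<omega> in M. T \<omega> = 0"
    | "\<not> (AE \<omega> in M. P \<omega> = 0)" "\<not> (AE \<omega> in M. T \<omega> = 0)"
    by blast
  then show ?thesis
  proof cases
    case 1
    then have "(\<integral>\<omega>. P \<omega> \<partial>M) = 0" "(\<integral>\<omega>. P \<omega> * T \<omega> \<partial>M) = 0"
      by (auto intro!: integral_eq_zero_AE)
    then show ?thesis by simp
  next
    case 2
    then have "(\<integral>\<omega>. T \<omega> \<partial>M) = 0" "(\<integral>\<omega>. P \<omega> * T \<omega> \<partial>M) = 0"
      by (auto intro!: integral_eq_zero_AE)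
    then show ?thesis by simp
  next
    case 3
    show ?thesis
    proof (cases "integrable M P \<and> integrable M T")
      case True
      then show ?thesis using indep_var_lebesgue_integral[OF ind] by simp
    next
      case False
      have "\<not> integrable M (\<lambda>\<omega>. P \<omega> * T \<omega>)"
        using False 3 indep_var_integrable_factor[OF ind] by blast
      then show ?thesis using False by (auto simp: not_integrable_integral_eq)
    qed
  qed
qed

text \<open>Links \<open>independent_vectors\<close> to \<open>indep_var\<close>: events of
  \<open>f (X \<omega>)\<close> are among the events of \<open>X\<close>, and likewise for
  \<open>g (Z \<omega>)\<close>, so independence passes to these smaller families.\<close>

lemma (in prob_space) independent_vectors_indep_var:
  fixes X :: "'a \<Rightarrow> real ^ 'n" and Z :: "'a \<Rightarrow> real ^ 'm"
    and f :: "real ^ 'n \<Rightarrow> real" and g :: "real ^ 'm \<Rightarrow> real"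
  assumes ind: "independent_vectors M X Z"
    and [measurable]: "f \<in> borel_measurable borel" "g \<in> borel_measurable borel"
  shows "indep_var borel (\<lambda>\<omega>. f (X \<omega>)) borel (\<lambda>\<omega>. g (Z \<omega>))"
proof -
  have [measurable]: "X \<in> borel_measurable M" "Z \<in> borel_measurable M"
    and ind_set: "indep_set {X -` B \<inter> space M | B. B \<in> sets borel}
      {Z -` B \<inter> space M | B. B \<in> sets borel}"
    using ind by (auto simp: independent_vectors_def)
  \<comment> \<open>\<open>indep_var_eq\<close> speaks of generated \<sigma>-algebras; independence
    extends to them from generators closed under intersection.\<close>
  have stable: "Int_stable {h -` B \<inter> space M | B. B \<in> sets borel}"
    for h :: "'a \<Rightarrow> 'x :: topological_space"
    unfolding Int_stable_def
  proof clarify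
    fix A B :: "'x set" assume "A \<in> sets borel" "B \<in> sets borel"
    then show "\<exists>C. h -` A \<inter> space M \<inter> (h -` B \<inter> space M) = h -` C \<inter> space M \<and> C \<in> sets borel"
      by (intro exI[of _ "A \<inter> B"]) auto
  qed
  have sub: "{(\<lambda>\<omega>. q (h \<omega>)) -` B \<inter> space M | B. B \<in> sets borel} \<subseteq>
      {h -` B \<inter> space M | B. B \<in> sets borel}"
    if [measurable]: "q \<in> borel_measurable borel"
    for h :: "'a \<Rightarrow> 'x :: topological_space" and q :: "'x \<Rightarrow> 'y :: topological_space"
  proof clarify
    fix B :: "'y set" assume B: "B \<in> sets borel"
    have "q -` B \<in> sets borel"
      using measurable_sets[OF that B] by simp
    then show "\<exists>C. (\<lambda>\<omega>. q (h \<omega>)) -` B \<inter> space M = h -` C \<inter> space M \<and> C \<in> sets borel"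
      by (intro exI[of _ "q -` B"]) auto
  qed
  have "indep_set {(\<lambda>\<omega>. f (X \<omega>)) -` B \<inter> space M | B. B \<in> sets borel}
      {(\<lambda>\<omega>. g (Z \<omega>)) -` B \<inter> space M | B. B \<in> sets borel}"
    using ind_set unfolding indep_set_def
    by (rule indep_sets_mono_sets) (use sub[of f X] sub[of g Z] in \<open>auto split: bool.splits\<close>)
  then show ?thesis
    unfolding indep_var_eq by (intro conjI indep_set_sigma_sets stable) auto
qed

section \<open>Diagonality of the third moment tensor in both cases\<close>

text \<open>Among three indices that are not all equal, one differs from both others. The swap and
  the rotation in \<open>perm\<close> generate all permutations, so this index can be moved to the
  first place.\<close>

lemma diagonal_tensorI:
  fixes T :: "'n tensor3"
  assumes perm: "\<And>i j k. T i j k = T j i k" "\<And>i j k. T i j k = T k i j"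
    and zero: "\<And>i j k. i \<noteq> j \<Longrightarrow> i \<noteq> k \<Longrightarrow> T i j k = 0"
  shows "diagonal_tensor T"
  unfolding diagonal_tensor_def
proof (intro allI impI)
  fix i j k :: 'n assume "\<not> (i = j \<and> j = k)"
  then consider "i \<noteq> j" "i \<noteq> k" | "j \<noteq> i" "j \<noteq> k" | "k \<noteq> i" "k \<noteq> j" by auto
  then show "T i j k = 0"
    by cases (metis zero perm)+
qed

lemma diagonal_moment3I:
  assumes "\<And>i j k. i \<noteq> j \<Longrightarrow> i \<noteq> k \<Longrightarrow> moment3 M X i j k = 0"
  shows "diagonal_tensor (moment3 M X)"
  by (rule diagonal_tensorI) (use assms in \<open>auto simp: moment3_def ac_simps\<close>)

lemma (in prob_space) scale_mixture_diagonal_moment3: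
  fixes \<epsilon> :: "'a \<Rightarrow> real ^ 'n" and Z :: "'a \<Rightarrow> real ^ 'm"
  assumes mix: "scale_mixture M \<epsilon> \<phi> K Z \<eta>"
    and [measurable]: "\<epsilon> \<in> borel_measurable M"
    and int: "\<And>i. integrable M (\<lambda>\<omega>. \<epsilon> \<omega> $ i)"
    and mean: "\<And>i. (\<integral>\<omega>. \<epsilon> \<omega> $ i \<partial>M) = 0"
    and nz: "\<And>i. \<not> (AE \<omega> in M. \<epsilon> \<omega> $ i = 0)"
  shows "diagonal_tensor (moment3 M \<epsilon>)"
proof (rule diagonal_moment3I)
  define \<tau> where "\<tau> i z = \<phi> ((K *v z) $ i)" for i z
  have [measurable]: "\<phi> \<in> borel_measurable borel" and pos: "\<And>x. 0 < \<phi> x"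
    and ind: "independent_vectors M \<eta> Z"
    and comp: "indep_vars (\<lambda>_. borel) (\<lambda>i \<omega>. \<eta> \<omega> $ i) UNIV"
    and eq: "AE \<omega> in M. \<forall>i. \<epsilon> \<omega> $ i = \<eta> \<omega> $ i * \<tau> i (Z \<omega>)"
    using mix by (auto simp: scale_mixture_def independent_components_def \<tau>_def elim!: AE_mp)
  have [measurable]: "\<tau> i \<in> borel_measurable borel" for i
    unfolding \<tau>_def matrix_vector_mult_def by simp
  have [measurable]: "\<eta> \<in> borel_measurable M" "Z \<in> borel_measurable M"
    using ind by (auto simp: independent_vectors_def)
  \<comment> \<open>No moments of \<eta> or \<tau> are given separately; they have to be extracted
    from those of the product \<epsilon>.\<close>
  have mean_\<eta>: "(\<integral>\<omega>. \<eta> \<omega> $ i \<partial>M) = 0" for i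
  proof -
    have eq_i: "AE \<omega> in M. \<epsilon> \<omega> $ i = \<eta> \<omega> $ i * \<tau> i (Z \<omega>)"
      using eq by auto
    have ind_i: "indep_var borel (\<lambda>\<omega>. \<eta> \<omega> $ i) borel (\<lambda>\<omega>. \<tau> i (Z \<omega>))"
      using ind by (rule independent_vectors_indep_var) measurable
    have "integrable M (\<lambda>\<omega>. \<eta> \<omega> $ i * \<tau> i (Z \<omega>))"
      using int[of i] eq_i by (subst integrable_cong_AE[symmetric]) auto
    moreover have "\<not> (AE \<omega> in M. \<eta> \<omega> $ i = 0)"
    proof
      assume "AE \<omega> in M. \<eta> \<omega> $ i = 0"
      with eq_i have "AE \<omega> in M. \<epsilon> \<omega> $ i = 0"
        by eventually_elim simp
      with nz show False by blast
    qed
    ultimately have "integrable M (\<lambda>\<omega>. \<tau> i (Z \<omega>))"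
      using indep_var_integrable_factor(1)[OF ind_i] by blast
    \<comment> \<open>Integrability matters here: without it the integral of the positive \<tau>
      would be 0 by convention.\<close>
    then have "(\<integral>\<omega>. \<tau> i (Z \<omega>) \<partial>M) \<noteq> 0"
      using pos by (subst integral_nonneg_eq_0_iff_AE)
        (auto simp: \<tau>_def less_imp_le pos[THEN less_imp_neq, symmetric])
    moreover have "(\<integral>\<omega>. \<eta> \<omega> $ i \<partial>M) * (\<integral>\<omega>. \<tau> i (Z \<omega>) \<partial>M) = (\<integral>\<omega>. \<epsilon> \<omega> $ i \<partial>M)"
      unfolding indep_var_integral_mult[OF ind_i, symmetric]
      using eq_i by (intro integral_cong_AE) auto
    ultimately show ?thesis
      using mean[of i] by simp
  qed
  fix i j k :: 'n assume ne: "i \<noteq> j" "i \<noteq> k"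
  \<comment> \<open>The two functions read disjoint sets of coordinates of \<eta>; for
    \<open>j = k\<close> the second set is a singleton.\<close>
  have "indep_var borel ((\<lambda>v. v i) \<circ> (\<lambda>\<omega>. \<lambda>l\<in>{i}. \<eta> \<omega> $ l))
      borel ((\<lambda>v. v j * v k) \<circ> (\<lambda>\<omega>. \<lambda>l\<in>{j, k}. \<eta> \<omega> $ l))"
    by (rule indep_var_compose, rule indep_var_restrict[OF comp])
      (use ne in \<open>auto intro!: borel_measurable_times measurable_component_singleton\<close>)
  then have "indep_var borel (\<lambda>\<omega>. \<eta> \<omega> $ i) borel (\<lambda>\<omega>. \<eta> \<omega> $ j * \<eta> \<omega> $ k)"
    by (simp add: comp_def)
  \<comment> \<open>The product rule \<open>indep_var_integral_mult\<close> applies whether or not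
    \<open>\<eta> \<omega> $ j * \<eta> \<omega> $ k\<close> is integrable.\<close>
  then have "(\<integral>\<omega>. \<eta> \<omega> $ i * (\<eta> \<omega> $ j * \<eta> \<omega> $ k) \<partial>M) = 0"
    using mean_\<eta> by (simp add: indep_var_integral_mult)
  moreover have "indep_var borel (\<lambda>\<omega>. \<eta> \<omega> $ i * (\<eta> \<omega> $ j * \<eta> \<omega> $ k))
      borel (\<lambda>\<omega>. \<tau> i (Z \<omega>) * \<tau> j (Z \<omega>) * \<tau> k (Z \<omega>))"
    by (rule independent_vectors_indep_var[OF ind]) measurable
  ultimately have "(\<integral>\<omega>. \<eta> \<omega> $ i * (\<eta> \<omega> $ j * \<eta> \<omega> $ k) *
      (\<tau> i (Z \<omega>) * \<tau> j (Z \<omega>) * \<tau> k (Z \<omega>)) \<partial>M) = 0"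
    by (simp add: indep_var_integral_mult)
  moreover have "moment3 M \<epsilon> i j k = (\<integral>\<omega>. \<eta> \<omega> $ i * (\<eta> \<omega> $ j * \<eta> \<omega> $ k) *
      (\<tau> i (Z \<omega>) * \<tau> j (Z \<omega>) * \<tau> k (Z \<omega>)) \<partial>M)"
    unfolding moment3_def
    by (rule integral_cong_AE) (use eq in \<open>auto elim!: AE_mp\<close>)
  ultimately show "moment3 M \<epsilon> i j k = 0"
    by simp
qed

lemma (in prob_space) mean_independent_diagonal_moment3:
  fixes \<epsilon> :: "'a \<Rightarrow> real ^ 'n"
  assumes mi: "mean_independent M \<epsilon>"
    and [measurable]: "\<epsilon> \<in> borel_measurable M"
    and int: "\<And>i j k. integrable M (\<lambda>\<omega>. \<epsilon> \<omega> $ i * \<epsilon> \<omega> $ j * \<epsilon> \<omega> $ k)"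
  shows "diagonal_tensor (moment3 M \<epsilon>)"
proof (rule diagonal_moment3I)
  fix i j k :: 'n assume ne: "i \<noteq> j" "i \<noteq> k"
  let ?F = "sigma_without M \<epsilon> i"
  have "finite_measure_subalgebra M ?F"
    by unfold_locales (rule subalgebra_sigma_without, measurable)
  then interpret F: sigma_finite_subalgebra M ?F
    by (rule finite_measure_subalgebra_is_sigma_finite)
  have coord: "(\<lambda>\<omega>. \<epsilon> \<omega> $ l) \<in> borel_measurable ?F" if "l \<noteq> i" for l
  proof -
    have "(\<lambda>\<omega>. \<lambda>j\<in>UNIV - {i}. \<epsilon> \<omega> $ j) \<in> ?F \<rightarrow>\<^sub>M Pi\<^sub>M (UNIV - {i}) (\<lambda>_. borel)"
      unfolding sigma_without_def by (rule measurable_vimage_algebra1) (auto simp: space_PiM)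
    then have "(\<lambda>\<omega>. (\<lambda>j\<in>UNIV - {i}. \<epsilon> \<omega> $ j) l) \<in> borel_measurable ?F"
      by (rule measurable_compose) (rule measurable_component_singleton, use that in simp)
    then show ?thesis using that by simp
  qed
  have "moment3 M \<epsilon> i j k = (\<integral>\<omega>. (\<epsilon> \<omega> $ j * \<epsilon> \<omega> $ k) * \<epsilon> \<omega> $ i \<partial>M)"
    by (simp add: moment3_def ac_simps)
  \<comment> \<open>Both \<open>j\<close> and \<open>k\<close> differ from \<open>i\<close>, so the
    factor in front is measurable for \<open>?F\<close>. The integrable triple product permits
    replacing \<open>\<epsilon> \<omega> $ i\<close> by its conditional expectation.\<close>
  also have "\<dots> = (\<integral>\<omega>. (\<epsilon> \<omega> $ j * \<epsilon> \<omega> $ k) * real_cond_exp M ?F (\<lambda>\<omega>. \<epsilon> \<omega> $ i) \<omega> \<partial>M)"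
    using ne int[of j k i] by (intro F.real_cond_exp_intg(2)[symmetric] borel_measurable_times coord) auto
  also have "\<dots> = 0"
    using mi by (intro integral_eq_zero_AE) (auto simp: mean_independent_def elim!: allE[of _ i] AE_mp)
  finally show "moment3 M \<epsilon> i j k = 0" .
qed

section \<open>Orthogonal matrices that keep a tensor diagonal\<close>

text \<open>A diagonal matrix on the left scales rows, so row \<open>i\<close> of
  \<open>D ** P\<close> is \<open>s i\<close> times the unit vector at
  \<open>\<sigma> i\<close>.\<close>

lemma signed_permutation_matrices_iff:
  fixes Q :: "real ^ 'n ^ 'n"
  shows
  "Q \<in> signed_permutation_matrices \<longleftrightarrow>
    (\<exists>s \<sigma>. (\<forall>i. s i \<in> {-1, 1}) \<and> bij \<sigma> \<and> (\<forall>i j. Q $ i $ j = (if j = \<sigma> i then s i else 0)))"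
proof -
  have eq: "(\<chi> i j. if i = j then s i else 0) ** (\<chi> i j. if j = \<sigma> i then 1 else 0) =
      (\<chi> i j. if j = \<sigma> i then s i else (0::real))" for s and \<sigma> :: "'n \<Rightarrow> 'n"
    by (simp add: matrix_matrix_mult_def vec_eq_iff if_distrib[of "\<lambda>x. x * _"] cong: if_cong)
  have "Q \<in> signed_permutation_matrices \<longleftrightarrow>
    (\<exists>s \<sigma>. (\<forall>i. s i \<in> {-1, 1}) \<and> bij \<sigma> \<and>
      Q = (\<chi> i j. if i = j then s i else 0) ** (\<chi> i j. if j = \<sigma> i then 1 else 0))"
    unfolding signed_permutation_matrices_def by blast
  then show ?thesis
    by (simp only: eq) (simp add: vec_eq_iff)
qed

lemma orthogonal_matrix_iff_right:
  "orthogonal_matrix (Q :: real ^ 'n ^ 'n) \<longleftrightarrow> Q ** transpose Q = mat 1"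
  by (metis matrix_left_right_inverse orthogonal_matrix_def)

lemma orthogonal_matrix_rows:
  "orthogonal_matrix (Q :: real ^ 'n ^ 'n) \<longleftrightarrow>
    (\<forall>i j. (\<Sum>l\<in>UNIV. Q $ i $ l * Q $ j $ l) = (if i = j then 1 else 0))"
  by (simp add: orthogonal_matrix_iff_right vec_eq_iff matrix_matrix_mult_def transpose_def mat_def)

lemma signed_permutation_orthogonal:
  assumes "Q \<in> signed_permutation_matrices"
  shows "orthogonal_matrix Q"
proof -
  obtain s \<sigma> where s: "\<forall>i. s i \<in> {-1, 1}" and \<sigma>: "bij \<sigma>"
    and Q: "\<And>i j. Q $ i $ j = (if j = \<sigma> i then s i else 0)"
    using assms by (auto simp: signed_permutation_matrices_iff)
  have "s i * s i = 1" for i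
    using s[rule_format, of i] by auto
  then show ?thesis
    using bij_is_inj[OF \<sigma>]
    by (auto simp: orthogonal_matrix_rows Q inj_eq if_distrib[of "\<lambda>x. x * _"] cong: if_cong)
qed

text \<open>For fixed \<open>i \<noteq> j\<close> the vector \<open>(Q i l * Q j l * t l)\<close>, indexed by \<open>l\<close>, lies in the kernel of
  \<open>Q\<close>. So rows \<open>i\<close> and \<open>j\<close> have disjoint supports off the zeros of \<open>t\<close>, and by orthogonality
  also at a single zero.\<close>

lemma orthogonal_diagonal_signed_permutation:
  fixes Q :: "real ^ 'n ^ 'n"
  assumes orth: "orthogonal_matrix Q"
    and diag: "diagonal_tensor (\<lambda>i j k. \<Sum>l\<in>UNIV. Q $ i $ l * Q $ j $ l * Q $ k $ l * t l)"
    and t: "card {l. t l = 0} \<le> 1"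
  shows "Q \<in> signed_permutation_matrices"
proof -
  have rows: "(\<Sum>l\<in>UNIV. Q $ i $ l * Q $ j $ l) = (if i = j then 1 else 0)" for i j
    using orth by (auto simp: orthogonal_matrix_rows)
  have disj: "Q $ i $ l * Q $ j $ l = 0" if ne: "i \<noteq> j" for i j l
  proof -
    define v where "v = (\<chi> l. Q $ i $ l * Q $ j $ l * t l)"
    have "Q *v v = 0"
      using diag ne
      by (simp add: diagonal_tensor_def v_def matrix_vector_mult_def vec_eq_iff ac_simps)
    then have "transpose Q *v (Q *v v) = 0"
      by simp
    then have "v = 0"
      using orth by (simp add: matrix_vector_mul_assoc orthogonal_matrix_def)
    then have off: "Q $ i $ m * Q $ j $ m = 0" if "t m \<noteq> 0" for m
      using that by (auto simp: v_def vec_eq_iff)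
    show ?thesis
    proof (cases "t l = 0")
      case True
      then have "t m \<noteq> 0" if "m \<noteq> l" for m
        using t that by (auto simp: card_le_Suc0_iff_eq)
      then have "(\<Sum>m\<in>UNIV. Q $ i $ m * Q $ j $ m) = (\<Sum>m\<in>{l}. Q $ i $ m * Q $ j $ m)"
        by (intro sum.mono_neutral_right) (auto simp: off)
      then show ?thesis
        using rows[of i j] ne by simp
    qed (rule off)
  qed
  \<comment> \<open>A row of norm 1 has a nonzero entry, and \<sigma> selects one. Disjoint supports
    make \<sigma> injective, hence bijective on the finite index type.\<close>
  have "\<exists>l. Q $ i $ l \<noteq> 0" for i
    using rows[of i i] by (auto intro: ccontr)
  then obtain \<sigma> where \<sigma>: "\<And>i. Q $ i $ \<sigma> i \<noteq> 0"
    by metis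
  have "inj \<sigma>"
  proof (rule injI, rule ccontr)
    fix i j assume "\<sigma> i = \<sigma> j" "i \<noteq> j"
    then show False
      using disj[of i j "\<sigma> i"] \<sigma>[of i] \<sigma>[of j] by simp
  qed
  then have bij: "bij \<sigma>"
    by (simp add: bij_def finite_UNIV_inj_surj)
  \<comment> \<open>Column \<open>l = \<sigma> j\<close> has a nonzero entry in row
    \<open>j\<close>, so every other row vanishes there.\<close>
  have Q: "Q $ i $ l = (if l = \<sigma> i then Q $ i $ \<sigma> i else 0)" for i l
  proof -
    obtain j where j: "l = \<sigma> j"
      using bij by (metis bij_pointE)
    show ?thesis
      using disj[of i j l] \<sigma>[of j] j bij_is_inj[OF bij] by (auto simp: inj_eq)
  qed
  have "Q $ i $ \<sigma> i \<in> {-1, 1}" for i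
  proof -
    have "(\<Sum>l\<in>UNIV. Q $ i $ l * Q $ i $ l) = (\<Sum>l\<in>{\<sigma> i}. Q $ i $ l * Q $ i $ l)"
      by (intro sum.mono_neutral_right) (auto simp: Q[of i])
    then have "(Q $ i $ \<sigma> i)\<^sup>2 = 1"
      using rows[of i i] by (simp add: power2_eq_square)
    then show ?thesis
      by (auto simp: power2_eq_1_iff)
  qed
  note sign = this
  show ?thesis
    unfolding signed_permutation_matrices_iff
    by (intro exI[of _ "\<lambda>i. Q $ i $ \<sigma> i"] exI[of _ \<sigma>] conjI allI; fact bij Q sign)
qed

text \<open>A nonzero summand needs \<open>l = \<sigma> i = \<sigma> j = \<sigma> k\<close>, which
  forces equal indices since \<sigma> is injective.\<close>

lemma signed_permutation_diagonal:
  assumes "Q \<in> signed_permutation_matrices"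
  shows "diagonal_tensor (\<lambda>i j k. \<Sum>l\<in>UNIV. Q $ i $ l * Q $ j $ l * Q $ k $ l * t l)"
proof -
  obtain s \<sigma> where \<sigma>: "bij \<sigma>" and Q: "\<And>i j. Q $ i $ j = (if j = \<sigma> i then s i else 0)"
    using assms by (auto simp: signed_permutation_matrices_iff)
  show ?thesis
    unfolding diagonal_tensor_def
    by (intro allI impI sum.neutral) (use bij_is_inj[OF \<sigma>] in \<open>auto simp: Q inj_eq\<close>)
qed

section \<open>Moments under linear maps\<close>

lemma sum_mult_sum_mult_sum:
  fixes f :: "'a \<Rightarrow> 'd :: semiring_0"
  shows "sum f A * sum g B * sum h C = (\<Sum>a\<in>A. \<Sum>b\<in>B. \<Sum>c\<in>C. f a * g b * h c)"
proof -
  have "sum f A * sum g B * sum h C = (\<Sum>a\<in>A. f a * (\<Sum>b\<in>B. g b * sum h C))"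
    by (simp only: sum_distrib_right mult.assoc)
  then show ?thesis
    by (simp only: sum_distrib_left mult.assoc)
qed

text \<open>Third moments are multilinear, and diagonality leaves only the terms
  \<open>a = b = c\<close> of the triple sum. The result has the form treated in
  \<open>orthogonal_diagonal_signed_permutation\<close>.\<close>

lemma moment3_matrix_vector_mult:
  assumes int: "\<And>i j k. integrable M (\<lambda>\<omega>. X \<omega> $ i * X \<omega> $ j * X \<omega> $ k)"
    and diag: "diagonal_tensor (moment3 M X)"
  shows "moment3 M (\<lambda>\<omega>. Q *v X \<omega>) =
    (\<lambda>i j k. \<Sum>l\<in>UNIV. Q $ i $ l * Q $ j $ l * Q $ k $ l * moment3 M X l l l)"
proof (intro ext)
  fix i j k
  have "moment3 M (\<lambda>\<omega>. Q *v X \<omega>) i j k = (\<integral>\<omega>. (\<Sum>a\<in>UNIV. \<Sum>b\<in>UNIV. \<Sum>c\<in>UNIV.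
      Q $ i $ a * Q $ j $ b * Q $ k $ c * (X \<omega> $ a * X \<omega> $ b * X \<omega> $ c)) \<partial>M)"
    unfolding moment3_def matrix_vector_mult_def vec_lambda_beta sum_mult_sum_mult_sum
    by (simp add: ac_simps)
  also have "\<dots> = (\<Sum>a\<in>UNIV. \<Sum>b\<in>UNIV. \<Sum>c\<in>UNIV.
      Q $ i $ a * Q $ j $ b * Q $ k $ c * moment3 M X a b c)"
    by (simp add: int moment3_def)
  also have "\<dots> = (\<Sum>a\<in>UNIV. \<Sum>b\<in>UNIV. \<Sum>c\<in>UNIV.
      if b = a then (if c = a then Q $ i $ a * Q $ j $ a * Q $ k $ a * moment3 M X a a a else 0) else 0)"
    using diag by (intro sum.cong refl) (auto simp: diagonal_tensor_def)
  also have "\<dots> = (\<Sum>l\<in>UNIV. Q $ i $ l * Q $ j $ l * Q $ k $ l * moment3 M X l l l)"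
    by (simp add: if_distrib[of "sum _"] sum.delta' sum.If_cases)
  finally show "moment3 M (\<lambda>\<omega>. Q *v X \<omega>) i j k =
    (\<Sum>l\<in>UNIV. Q $ i $ l * Q $ j $ l * Q $ k $ l * moment3 M X l l l)" .
qed

lemma mean_matrix_vector_mult:
  fixes X :: "'a \<Rightarrow> real ^ 'n"
  assumes "\<And>i. integrable M (\<lambda>\<omega>. X \<omega> $ i)" "\<And>i. (\<integral>\<omega>. X \<omega> $ i \<partial>M) = 0"
  shows "(\<integral>\<omega>. (Q *v X \<omega>) $ i \<partial>M) = 0"
  by (simp add: matrix_vector_mult_def assms)

text \<open>Covariance is bilinear and that of \<open>X\<close> is the identity. Thus unit
  covariance of the image amounts to orthogonality of \<open>Q\<close>.\<close>

lemma covariance_matrix_matrix_vector_mult: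
  fixes X :: "'a \<Rightarrow> real ^ 'n" and Q :: "real ^ 'n ^ 'n"
  assumes int1: "\<And>i. integrable M (\<lambda>\<omega>. X \<omega> $ i)"
    and int2: "\<And>i j. integrable M (\<lambda>\<omega>. X \<omega> $ i * X \<omega> $ j)"
    and mean: "\<And>i. (\<integral>\<omega>. X \<omega> $ i \<partial>M) = 0"
    and cov: "covariance_matrix M X = mat 1"
  shows "covariance_matrix M (\<lambda>\<omega>. Q *v X \<omega>) = Q ** transpose Q"
proof -
  have cov': "(\<integral>\<omega>. X \<omega> $ a * X \<omega> $ b \<partial>M) = (if a = b then 1 else 0)" for a b
    using cov by (auto simp: covariance_matrix_def vec_eq_iff mean mat_def)
  have "(\<integral>\<omega>. (Q *v X \<omega>) $ i * (Q *v X \<omega>) $ j \<partial>M) = (\<Sum>l\<in>UNIV. Q $ i $ l * Q $ j $ l)" for i j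
  proof -
    have "(\<integral>\<omega>. (Q *v X \<omega>) $ i * (Q *v X \<omega>) $ j \<partial>M) =
        (\<integral>\<omega>. (\<Sum>a\<in>UNIV. \<Sum>b\<in>UNIV. Q $ i $ a * Q $ j $ b * (X \<omega> $ a * X \<omega> $ b)) \<partial>M)"
      by (simp add: matrix_vector_mult_def sum_product ac_simps)
    also have "\<dots> = (\<Sum>a\<in>UNIV. \<Sum>b\<in>UNIV. Q $ i $ a * Q $ j $ b * (if a = b then 1 else 0))"
      by (simp add: int2 cov')
    finally show ?thesis
      by (simp add: if_distrib[of "\<lambda>x. _ * x"] cong: if_cong)
  qed
  then show ?thesis
    by (simp add: covariance_matrix_def mean_matrix_vector_mult[OF int1 mean] vec_eq_iff
        matrix_matrix_mult_def transpose_def)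
qed

section \<open>Diagonality and identifiability\<close>

theorem corollary5p7:
  fixes M :: "'a measure"
    and Y \<epsilon> \<eta> :: "'a \<Rightarrow> real ^ 'n"
    and Z :: "'a \<Rightarrow> real ^ 'm"
    and A :: "real ^ 'n ^ 'n"
    and K :: "real ^ 'm ^ 'n"
    and \<phi> :: "real \<Rightarrow> real"
    and h3 :: "('a \<Rightarrow> real ^ 'n) \<Rightarrow> 'n tensor3"
  assumes "prob_space M"
    and "Y \<in> borel_measurable M"
    and "invertible A"
    and "\<epsilon> = (\<lambda>\<omega>. A *v Y \<omega>)"
    and "(\<integral>\<omega>. \<epsilon> \<omega> \<partial>M) = 0"
    and "covariance_matrix M \<epsilon> = mat 1"
    and "\<forall>i. integrable M (\<lambda>\<omega>. \<bar>\<epsilon> \<omega> $ i\<bar> ^ 3)"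
    and "scale_mixture M \<epsilon> \<phi> K Z \<eta> \<or> mean_independent M \<epsilon>"
    and "h3 = moment3 M \<or> h3 = cumulant3 M"
  shows "h3 \<epsilon> = moment3 M \<epsilon> \<and> h3 \<epsilon> = cumulant3 M \<epsilon> \<and> diagonal_tensor (h3 \<epsilon>) \<and>
    (CARD('n) - 1 \<le> card {i. h3 \<epsilon> i i i \<noteq> 0} \<longrightarrow>
      {B. invertible B \<and> covariance_matrix M (\<lambda>\<omega>. B *v Y \<omega>) = mat 1 \<and>
          diagonal_tensor (h3 (\<lambda>\<omega>. B *v Y \<omega>))} =
      {Q ** A | Q. Q \<in> signed_permutation_matrices})"
proof -
  interpret prob_space M by fact
  have \<epsilon>: "\<epsilon> = (\<lambda>\<omega>. A *v Y \<omega>)" by fact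
  have [measurable]: "\<epsilon> \<in> borel_measurable M"
    unfolding \<epsilon> by (rule measurable_compose[OF assms(2)])
      (intro borel_measurable_continuous_onI matrix_vector_mult_linear_continuous_on)
  have cube: "integrable M (\<lambda>\<omega>. \<bar>\<epsilon> \<omega> $ i\<bar> ^ 3)" for i
    using assms(7) by blast
  have int3: "integrable M (\<lambda>\<omega>. \<epsilon> \<omega> $ i * \<epsilon> \<omega> $ j * \<epsilon> \<omega> $ k)" for i j k
    by (rule integrable_mult3) (auto simp: cube)
  have int2: "integrable M (\<lambda>\<omega>. \<epsilon> \<omega> $ i * \<epsilon> \<omega> $ j)" for i j
    using integrable_mult3[of "\<lambda>\<omega>. \<epsilon> \<omega> $ i" M "\<lambda>\<omega>. \<epsilon> \<omega> $ j" "\<lambda>_. 1"] by (simp add: cube)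
  have int1: "integrable M (\<lambda>\<omega>. \<epsilon> \<omega> $ i)" for i
    using integrable_mult3[of "\<lambda>\<omega>. \<epsilon> \<omega> $ i" M "\<lambda>_. 1" "\<lambda>_. 1"] by (simp add: cube)
  have mean: "(\<integral>\<omega>. \<epsilon> \<omega> $ i \<partial>M) = 0" for i
  proof -
    \<comment> \<open>Integrability of the vector \<epsilon> lets coordinates be taken inside its
      integral, which turns the vector equation for the mean into scalar ones.\<close>
    have "integrable M \<epsilon>"
    proof (rule Bochner_Integration.integrable_bound)
      show "integrable M (\<lambda>\<omega>. \<Sum>i\<in>UNIV. \<bar>\<epsilon> \<omega> $ i\<bar>)"
        using int1 by simp
      show "AE \<omega> in M. norm (\<epsilon> \<omega>) \<le> norm (\<Sum>i\<in>UNIV. \<bar>\<epsilon> \<omega> $ i\<bar>)"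
        by (intro AE_I2) (simp add: norm_le_l1_cart sum_nonneg)
    qed simp
    then have "(\<integral>\<omega>. \<epsilon> \<omega> \<bullet> axis i 1 \<partial>M) = (\<integral>\<omega>. \<epsilon> \<omega> \<partial>M) \<bullet> axis i 1"
      by (intro integral_inner_left) auto
    then show ?thesis
      using assms(5) by (simp add: inner_axis)
  qed
  \<comment> \<open>Unit variance excludes a vanishing coordinate; in case (a) this keeps the
    components of \<eta> from being almost surely 0.\<close>
  have nz: "\<not> (AE \<omega> in M. \<epsilon> \<omega> $ i = 0)" for i
  proof
    assume "AE \<omega> in M. \<epsilon> \<omega> $ i = 0"
    then have "(\<integral>\<omega>. \<epsilon> \<omega> $ i * \<epsilon> \<omega> $ i \<partial>M) = 0"
      by (intro integral_eq_zero_AE) auto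
    moreover have "(\<integral>\<omega>. \<epsilon> \<omega> $ i * \<epsilon> \<omega> $ i \<partial>M) = 1"
      using assms(6) by (auto simp: covariance_matrix_def vec_eq_iff mean mat_def)
    ultimately show False by simp
  qed
  have diag: "diagonal_tensor (moment3 M \<epsilon>)"
    using assms(8) scale_mixture_diagonal_moment3[of \<epsilon> \<phi> K Z \<eta>] mean_independent_diagonal_moment3[of \<epsilon>]
      int1 int3 mean nz by auto
  \<comment> \<open>Every linear image of \<epsilon> is again centred, so both readings of
    \<open>h3\<close> agree on all candidates.\<close>
  have h3: "h3 (\<lambda>\<omega>. Q *v \<epsilon> \<omega>) = moment3 M (\<lambda>\<omega>. Q *v \<epsilon> \<omega>)" for Q :: "real ^ 'n ^ 'n"
    using assms(9) cumulant3_eq_moment3[of M "\<lambda>\<omega>. Q *v \<epsilon> \<omega>"]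
      mean_matrix_vector_mult[OF int1 mean] by auto
  have cum: "cumulant3 M \<epsilon> = moment3 M \<epsilon>"
    by (rule cumulant3_eq_moment3) (rule mean)
  have h3_\<epsilon>: "h3 \<epsilon> = moment3 M \<epsilon>"
    using assms(9) cum by auto
  \<comment> \<open>The constraints on \<open>B\<close> are studied through \<open>Q\<close> with
    \<open>B = Q ** A\<close>, since then \<open>B *v Y \<omega>\<close> is
    \<open>Q *v \<epsilon> \<omega>\<close>.\<close>
  have admissible: "covariance_matrix M (\<lambda>\<omega>. Q *v \<epsilon> \<omega>) = mat 1 \<and>
      diagonal_tensor (h3 (\<lambda>\<omega>. Q *v \<epsilon> \<omega>)) \<longleftrightarrow> Q \<in> signed_permutation_matrices"
    if many: "CARD('n) - 1 \<le> card {i. h3 \<epsilon> i i i \<noteq> 0}" for Q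
  proof -
    let ?t = "\<lambda>l. moment3 M \<epsilon> l l l"
    have "{l. ?t l = 0} = UNIV - {l. ?t l \<noteq> 0}"
      by auto
    then have "card {l. ?t l = 0} = CARD('n) - card {l. ?t l \<noteq> 0}"
      by (simp only: card_Diff_subset[OF finite subset_UNIV])
    \<comment> \<open>At least d - 1 nonzero diagonal entries leave at most one zero, the form that
      \<open>orthogonal_diagonal_signed_permutation\<close> uses.\<close>
    then have one: "card {l. ?t l = 0} \<le> 1"
      using many h3_\<epsilon> by simp
    have cov: "covariance_matrix M (\<lambda>\<omega>. Q *v \<epsilon> \<omega>) = mat 1 \<longleftrightarrow> orthogonal_matrix Q"
      using covariance_matrix_matrix_vector_mult[OF int1 int2 mean assms(6)]
      by (simp add: orthogonal_matrix_iff_right)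
    show ?thesis
      unfolding cov h3 moment3_matrix_vector_mult[OF int3 diag]
      using orthogonal_diagonal_signed_permutation[of Q ?t] one
        signed_permutation_orthogonal[of Q] signed_permutation_diagonal[of Q ?t] by blast
  qed
  have BY: "(\<lambda>\<omega>. (Q ** A) *v Y \<omega>) = (\<lambda>\<omega>. Q *v \<epsilon> \<omega>)" for Q :: "real ^ 'n ^ 'n"
    by (simp add: \<epsilon> matrix_vector_mul_assoc)
  have "{B. invertible B \<and> covariance_matrix M (\<lambda>\<omega>. B *v Y \<omega>) = mat 1 \<and>
        diagonal_tensor (h3 (\<lambda>\<omega>. B *v Y \<omega>))} = {Q ** A | Q. Q \<in> signed_permutation_matrices}"
    if many: "CARD('n) - 1 \<le> card {i. h3 \<epsilon> i i i \<noteq> 0}"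
  proof (intro equalityI subsetI)
    fix B assume B: "B \<in> {B. invertible B \<and> covariance_matrix M (\<lambda>\<omega>. B *v Y \<omega>) = mat 1 \<and>
        diagonal_tensor (h3 (\<lambda>\<omega>. B *v Y \<omega>))}"
    obtain A' where "A' ** A = mat 1"
      using assms(3) by (auto simp: invertible_def)
    \<comment> \<open>\<open>B ** A'\<close> is the matrix \<open>Q\<close> of
      \<open>admissible\<close> that belongs to \<open>B\<close>.\<close>
    then have "B = (B ** A') ** A"
      by (simp add: matrix_mul_assoc[symmetric])
    then show "B \<in> {Q ** A | Q. Q \<in> signed_permutation_matrices}"
      using B admissible[OF many, of "B ** A'"] BY[of "B ** A'"] by auto
  next
    fix B assume "B \<in> {Q ** A | Q. Q \<in> signed_permutation_matrices}"
    then obtain Q where Q: "Q \<in> signed_permutation_matrices" and B: "B = Q ** A"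
      by auto
    have "invertible Q"
      using signed_permutation_orthogonal[OF Q] by (auto simp: orthogonal_matrix_def invertible_def)
    then show "B \<in> {B. invertible B \<and> covariance_matrix M (\<lambda>\<omega>. B *v Y \<omega>) = mat 1 \<and>
        diagonal_tensor (h3 (\<lambda>\<omega>. B *v Y \<omega>))}"
      using admissible[OF many, of Q] Q assms(3) by (simp add: B BY invertible_mult)
  qed
  then show ?thesis
    using h3_\<epsilon> cum diag by simp
qed

end
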